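(* For every $n\in\omega=\{0,1,2,\dots\}$ there is an $n$-topological space $\mathbf X$, i.e. a set $X$ endowed with topologies $\tau_0\subset\tau_1\subset\dots\subset\tau_{n-1}$, such that $|\mathsf K(\mathbf X)|=K(n)$ and $|\mathsf K_2(\mathbf X)|=2\cdot K(n)$, where $K(n)=\sum_{i,j=0}^{n}\binom{i+j}{i}\binom{i+j}{j}$.
   Context: For a set $X$, $\mathcal P(X)$ is its power-set and $\mathcal P(X)^{\mathcal P(X)}$ is the monoid (under composition) of all self-maps of $\mathcal P(X)$. For a topology $\tau$ on $X$, $\breve\tau,\bar\tau:\mathcal P(X)\to\mathcal P(X)$ denote the operators of taking the interior and the closure with respect to $\tau$; $c:\mathcal P(X)\to\mathcal P(X)$, $c(A)=X\setminus A$, is the complement operator. An $n$-topological space is a set $X$ with a monotone sequence of topologies $\tau_0\subset\tau_1\subset\dots\subset\tau_{n-1}$ (the empty sequence if $n=0$). Its Kuratowski monoid $\mathsf K(\mathbf X)$ is the submonoid of $\mathcal P(X)^{\mathcal P(X)}$ (containing the identity) generated by all $\breve\tau_i,\bar\tau_i$, $i<n$; its full Kuratowski monoid $\mathsf K_2(\mathbf X)$ is the submonoid generated by $c$ and all $\bar\tau_i$, $i<n$. *)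

theory Defs
  imports "HOL-Analysis.Abstract_Topology" "HOL-Algebra.Group"
begin

text \<open>The sequence of topologies on \<open>X\<close> is \<open>T 0, \<dots>, T (n - 1)\<close>; the values \<open>T i\<close> for
  \<open>i \<ge> n\<close> are irrelevant. Inclusions between consecutive topologies need not be strict.\<close>

definition n_topological_space :: "nat \<Rightarrow> 'a set \<Rightarrow> (nat \<Rightarrow> 'a topology) \<Rightarrow> bool" where
  "n_topological_space n X T \<longleftrightarrow>
     (\<forall>i<n. topspace (T i) = X) \<and>
     (\<forall>i j. i \<le> j \<and> j < n \<longrightarrow> {U. openin (T i) U} \<subseteq> {U. openin (T j) U})"

text \<open>Self-maps of \<open>\<P>(X)\<close> are represented by functions that are \<open>undefined\<close> outside
  \<open>Pow X\<close>, so that equality of functions is equality of self-maps of \<open>Pow X\<close>.\<close>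

definition powerset_maps :: "'a set \<Rightarrow> ('a set \<Rightarrow> 'a set) monoid" where
  "powerset_maps X =
     \<lparr>carrier = Pow X \<rightarrow>\<^sub>E Pow X,
      mult = (\<lambda>f g. compose (Pow X) f g),
      one = (\<lambda>A\<in>Pow X. A)\<rparr>"

definition submonoid_generated :: "('a, 'b) monoid_scheme \<Rightarrow> 'a set \<Rightarrow> 'a set" where
  "submonoid_generated G S = \<Inter>{H. submonoid H G \<and> S \<subseteq> H}"

definition interior_map :: "'a set \<Rightarrow> 'a topology \<Rightarrow> 'a set \<Rightarrow> 'a set" where
  "interior_map X \<tau> = (\<lambda>A\<in>Pow X. \<tau> interior_of A)"

definition closure_map :: "'a set \<Rightarrow> 'a topology \<Rightarrow> 'a set \<Rightarrow> 'a set" where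
  "closure_map X \<tau> = (\<lambda>A\<in>Pow X. \<tau> closure_of A)"

definition complement_map :: "'a set \<Rightarrow> 'a set \<Rightarrow> 'a set" where
  "complement_map X = (\<lambda>A\<in>Pow X. X - A)"

definition kuratowski_monoid :: "nat \<Rightarrow> 'a set \<Rightarrow> (nat \<Rightarrow> 'a topology) \<Rightarrow> ('a set \<Rightarrow> 'a set) set" where
  "kuratowski_monoid n X T =
     submonoid_generated (powerset_maps X)
       ((\<lambda>i. interior_map X (T i)) ` {..<n} \<union> (\<lambda>i. closure_map X (T i)) ` {..<n})"

definition full_kuratowski_monoid :: "nat \<Rightarrow> 'a set \<Rightarrow> (nat \<Rightarrow> 'a topology) \<Rightarrow> ('a set \<Rightarrow> 'a set) set" where
  "full_kuratowski_monoid n X T =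
     submonoid_generated (powerset_maps X)
       (insert (complement_map X) ((\<lambda>i. closure_map X (T i)) ` {..<n}))"

definition kuratowski_number :: "nat \<Rightarrow> nat" where
  "kuratowski_number n = (\<Sum>i=0..n. \<Sum>j=0..n. (i + j choose i) * (i + j choose j))"

end

theory Submission
  imports Defs
begin

text \<open>Index the topologies from the finest to the coarsest by levels \<open>1, \<dots>, n\<close>, and let level \<open>0\<close> be the
discrete topology, whose closure and interior are the identity. An element of the Kuratowski monoid
is given by a word of letters \<open>(b, s)\<close>: closure (\<open>b = True\<close>) or interior (\<open>b = False\<close>) of level \<open>s\<close>,
the first letter being applied first. While a word is read, keep track of the largest closure level
\<open>i\<close> and the largest interior level \<open>j\<close> met so far. The point \<open>(i, j)\<close> moves along a monotone lattice
path that starts at the origin; call it the record path of the word.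

The operator of a word depends only on the record path of the word and on that of the reversed word
(\<open>normal_form\<close>). The reason is one inequality: an operator \<open>f\<close> built from levels at most those of a
closure \<open>c\<close> and an interior \<open>k\<close> lies between \<open>k\<close> and \<open>c\<close>, so that \<open>c \<circ> f \<circ> k = c \<circ> k\<close> and
\<open>k \<circ> f \<circ> c = k \<circ> c\<close>. The two record paths end in the same point \<open>(i, j)\<close>, any two paths with a common
end point occur, and there are \<open>(i + j choose i)\<^sup>2\<close> such pairs. Summing over \<open>i, j \<le> n\<close> gives the
Kuratowski number as an upper bound for every space.

For the bound to be attained, different pairs of paths have to give different operators in some space.
Appending a letter to a word changes the pair of record paths in a way that depends on the pair only,
so words act on pairs of paths, and acting on the pair of empty paths recovers the two record paths
(\<open>fold_path_pair_act\<close>). There is a partial order on the pairs for which the letters act as closure and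
interior operators of increasing strength (\<open>path_pair_poset\<close>). Finally, every finite poset with such
operators sits inside the power set of a finite set \<open>X\<close> with nested topologies, in such a way that
its operators become the topological ones: take the up-sets as points and represent \<open>w\<close> by the set
of the up-sets that contain it (\<open>closure_test_set\<close>, \<open>interior_test_set\<close>).

Complements only double the count. A complement can be moved past a word at the cost of exchanging
closures and interiors, so the full monoid consists of the word operators and their complements,
and the two kinds differ at the empty set, which every word operator fixes.\<close>

section \<open>Words and their record paths\<close>

type_synonym letter = "bool \<times> nat"

fun strike :: "nat \<Rightarrow> bool \<Rightarrow> bool list \<Rightarrow> bool list" where
  "strike k b [] = []"
| "strike k b (c # Q) = (if c = b \<and> 0 < k then strike (k - 1) b Q else c # strike k b Q)"

text \<open>A path is a list of unit steps, \<open>True\<close> for a step in the closure direction. Putting a letter of level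
\<open>k\<close> in front of a word makes its record path start with \<open>k\<close> steps; the first \<open>k\<close> steps of that kind
on the old path are no longer records. Putting it at the end only adds the steps by which it exceeds
the level reached so far.\<close>

definition push_front :: "letter \<Rightarrow> bool list \<Rightarrow> bool list" where
  "push_front l Q = replicate (snd l) (fst l) @ strike (snd l) (fst l) Q"

definition push_back :: "letter \<Rightarrow> bool list \<Rightarrow> bool list" where
  "push_back l P = P @ replicate (snd l - count_list P (fst l)) (fst l)"

primrec records :: "letter list \<Rightarrow> bool list" where
  "records [] = []"
| "records (l # w) = push_front l (records w)"

lemma count_list_replicate [simp]: "count_list (replicate k b) c = (if b = c then k else 0)"
  by (induction k) auto

lemma count_list_strike:
  "count_list (strike k b Q) c = (if c = b then count_list Q c - k else count_list Q c)"
  by (induction Q arbitrary: k) auto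

lemma count_list_push_front:
  "count_list (push_front (b, k) Q) c = (if c = b then max k (count_list Q c) else count_list Q c)"
  by (auto simp: push_front_def count_list_strike max_def)

lemma count_list_push_back:
  "count_list (push_back (b, k) P) c = (if c = b then max k (count_list P c) else count_list P c)"
  by (auto simp: push_back_def max_def)

lemma strike_append:
  "strike k b (P @ Q) = strike k b P @ strike (k - count_list P b) b Q"
  by (induction P arbitrary: k) auto

lemma strike_replicate: "strike k b (replicate m c) = (if b = c then replicate (m - k) c else replicate m c)"
proof (induction m arbitrary: k)
  case (Suc m)
  then show ?case by (cases k) auto
qed simp

lemma push_front_push_back: "push_front l (push_back l' P) = push_back l' (push_front l P)"
proof -
  obtain b k where l: "l = (b, k)" by force
  obtain c m where l': "l' = (c, m)" by force
  have "m - (x + (k - x)) = m - (k + (x - k))" for x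
    by linarith
  then show ?thesis
    by (simp add: l l' push_front_def push_back_def strike_append strike_replicate count_list_strike)
qed

text \<open>Thus the record path, defined by recursion from the front, can also be read off while the word is
extended at the end. Appending a letter \<open>l\<close> to \<open>w\<close> therefore acts by \<open>push_back l\<close> on the record path
of \<open>w\<close> and by \<open>push_front l\<close> on that of \<open>rev w\<close>.\<close>

lemma records_snoc: "records (w @ [l]) = push_back l (records w)"
proof (induction w)
  case Nil
  show ?case by (simp add: push_front_def push_back_def)
qed (simp add: push_front_push_back)

lemma fold_push_back: "fold push_back w [] = records w"
  by (induction w rule: rev_induct) (simp_all add: records_snoc)

lemma fold_push_front: "fold push_front w [] = records (rev w)"
  by (induction w rule: rev_induct) simp_all

definition levels_within :: "(bool \<Rightarrow> nat) \<Rightarrow> letter list \<Rightarrow> bool" where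
  "levels_within m w \<longleftrightarrow> (\<forall>l\<in>set w. snd l \<le> m (fst l))"

lemma levels_within_simps [simp]:
  "levels_within m []"
  "levels_within m (l # w) \<longleftrightarrow> snd l \<le> m (fst l) \<and> levels_within m w"
  "levels_within m (v @ w) \<longleftrightarrow> levels_within m v \<and> levels_within m w"
  "levels_within m (rev w) \<longleftrightarrow> levels_within m w"
  by (auto simp: levels_within_def)

lemma levels_within_mono: "levels_within m w \<Longrightarrow> (\<And>b. m b \<le> m' b) \<Longrightarrow> levels_within m' w"
  by (force simp: levels_within_def dest: bspec intro: le_trans[of _ "m _" "m' _"])

text \<open>A record path ends at the largest levels of its word.\<close>

lemma levels_within_records_iff: "levels_within m w \<longleftrightarrow> (\<forall>b. count_list (records w) b \<le> m b)"
proof (induction w)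
  case (Cons l w)
  then show ?case
    by (cases l; cases "fst l") (simp_all add: count_list_push_front all_bool_eq conj_ac)
qed simp

lemma levels_within_records: "levels_within (count_list (records w)) w"
  by (simp add: levels_within_records_iff)

lemma count_list_records_rev: "count_list (records (rev w)) b = count_list (records w) b"
proof (rule antisym)
  show "count_list (records (rev w)) b \<le> count_list (records w) b"
    using levels_within_records_iff[of "count_list (records w)" "rev w"]
    by (simp add: levels_within_records)
  show "count_list (records w) b \<le> count_list (records (rev w)) b"
    using levels_within_records_iff[of "count_list (records (rev w))" w] levels_within_records[of "rev w"]
    by (simp only: levels_within_simps)
qed

lemma push_back_absorb: "levels_within (count_list P) w \<Longrightarrow> fold push_back w P = P"
  by (induction w) (simp_all add: push_back_def)

lemma records_append: "records (v @ w) = fold push_back w (records v)"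
  unfolding fold_push_back[symmetric] by simp

text \<open>The word of a path has one letter for each step, and each of its letters sets a record by one level.\<close>

primrec path_word_from :: "(bool \<Rightarrow> nat) \<Rightarrow> bool list \<Rightarrow> letter list" where
  "path_word_from m [] = []"
| "path_word_from m (b # P) = (b, Suc (m b)) # path_word_from (m(b := Suc (m b))) P"

definition path_word :: "bool list \<Rightarrow> letter list" where
  "path_word P = path_word_from (\<lambda>_. 0) P"

lemma path_word_from_snoc:
  "path_word_from m (P @ [b]) = path_word_from m P @ [(b, Suc (m b + count_list P b))]"
  by (induction P arbitrary: m) auto

lemma path_word_Nil [simp]: "path_word [] = []"
  by (simp add: path_word_def)

lemma path_word_snoc [simp]: "path_word (P @ [b]) = path_word P @ [(b, Suc (count_list P b))]"
  by (simp add: path_word_def path_word_from_snoc)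

lemma records_path_word: "records (path_word P) = P"
  by (induction P rule: rev_induct) (simp_all add: records_snoc push_back_def)

lemma levels_within_path_word: "levels_within m (path_word P) \<longleftrightarrow> (\<forall>b. count_list P b \<le> m b)"
  by (simp add: levels_within_records_iff records_path_word)

text \<open>Every pair of paths with a common end point is the pair of record paths of some word: after the
first path has been traced, the levels of the second one set no new record. Applied to the reversed
word, the lemma recovers the second path.\<close>

lemma records_path_pair:
  assumes "count_list P = count_list Q"
  shows "records (path_word P @ rev (path_word Q)) = P"
  using assms
  by (simp add: records_append records_path_word push_back_absorb levels_within_path_word)

section \<open>Words with equal record paths act equally\<close>

text \<open>The assumptions are the relations between closures and interiors that the normal form rests on.
They are stated for an abstract congruence because they are invariant under reversing words; each
consequence then comes together with its mirror image.\<close>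

locale word_congruence =
  fixes eqv :: "letter list \<Rightarrow> letter list \<Rightarrow> bool"  (infix "\<approx>" 50)
  assumes eqv_equivp: "equivp (\<approx>)"
    and eqv_context: "u \<approx> v \<Longrightarrow> x @ u @ y \<approx> x @ v @ y"
    and merge: "[(b, s), (b, t)] \<approx> [(b, max s t)]"
    and level_zero: "[(b, 0)] \<approx> []"
    and sandwich: "levels_within m x \<Longrightarrow>
      [(b, m b)] @ x @ [(\<not> b, m (\<not> b))] \<approx> [(b, m b), (\<not> b, m (\<not> b))]"
begin

lemma eqv_refl: "u \<approx> u"
  using eqv_equivp by (rule equivp_reflp)

lemma eqv_sym: "u \<approx> v \<Longrightarrow> v \<approx> u"
  using eqv_equivp by (rule equivp_symp)

lemma eqv_trans [trans]: "u \<approx> v \<Longrightarrow> v \<approx> w \<Longrightarrow> u \<approx> w"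
  using eqv_equivp by (rule equivp_transp)

lemma eqv_prefix: "u \<approx> v \<Longrightarrow> x @ u \<approx> x @ v"
  using eqv_context[of u v x "[]"] by simp

lemma eqv_suffix: "u \<approx> v \<Longrightarrow> u @ y \<approx> v @ y"
  using eqv_context[of u v "[]" y] by simp

text \<open>The two lemmas \<open>path_word_absorb_of_corner\<close> and \<open>path_word_corner\<close> feed each other in an induction
along \<open>P\<close>: the word of a path may be taken to end in both of its top levels, and this lets it swallow
everything below those levels that precedes a letter \<open>(c, k)\<close>.\<close>

lemma path_word_absorb_of_corner:
  assumes corner: "path_word P \<approx>
      path_word P @ [(\<not> d, count_list P (\<not> d)), (d, count_list P d)]"
    and k: "count_list P c \<le> k"
    and x: "levels_within ((count_list P)(c := k)) x"
  shows "path_word P @ x @ [(c, k)] \<approx> path_word P @ [(c, k)]"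
proof -
  define m where "m = (count_list P)(c := k)"
  let ?s = "[(\<not> d, count_list P (\<not> d)), (d, count_list P d)]"
  have collapse: "?s @ y @ [(c, k)] \<approx> ?s @ [(c, k)]" if "levels_within m y" for y
  proof (cases "d = c")
    case True
    have "[(\<not> c, m (\<not> c))] @ z @ [(\<not> \<not> c, m (\<not> \<not> c))] \<approx> [(\<not> c, m (\<not> c)), (\<not> \<not> c, m (\<not> \<not> c))]"
      if "levels_within m z" for z
      using that by (rule sandwich)
    from eqv_trans[OF this[of "(c, count_list P c) # y"] eqv_sym[OF this[of "[(c, count_list P c)]"]]]
      that k
    show ?thesis using True by (simp add: m_def)
  next
    case False
    then have d: "d = (\<not> c)" by simp
    have "[(\<not> c, m (\<not> c))] @ y @ [(\<not> \<not> c, m (\<not> \<not> c))] \<approx> [(\<not> c, m (\<not> c)), (\<not> \<not> c, m (\<not> \<not> c))]"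
      using that by (rule sandwich)
    from eqv_prefix[OF this, of "[(c, count_list P c)]"]
    show ?thesis by (simp add: d m_def)
  qed
  have "path_word P @ x @ [(c, k)] \<approx> (path_word P @ ?s) @ x @ [(c, k)]"
    using corner by (rule eqv_suffix)
  also have "(path_word P @ ?s) @ x @ [(c, k)] \<approx> (path_word P @ ?s) @ [(c, k)]"
    using eqv_prefix[OF collapse[of x], of "path_word P"] x by (simp add: m_def)
  also have "(path_word P @ ?s) @ [(c, k)] \<approx> path_word P @ [(c, k)]"
    using eqv_suffix[OF eqv_sym[OF corner]] .
  finally show ?thesis .
qed

lemma path_word_corner:
  "\<exists>d. path_word P \<approx> path_word P @ [(\<not> d, count_list P (\<not> d)), (d, count_list P d)]"
proof (induction P rule: rev_induct)
  case Nil
  have "[(\<not> True, 0)] @ [(True, 0)] \<approx> []"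
    using eqv_trans[OF eqv_suffix[OF level_zero, of False "[(True, 0)]"]] level_zero[of True] by simp
  then show ?case by (intro exI[of _ True]) (auto intro: eqv_sym)
next
  case (snoc c P)
  then obtain d where d: "path_word P \<approx>
      path_word P @ [(\<not> d, count_list P (\<not> d)), (d, count_list P d)]" ..
  let ?k = "Suc (count_list P c)"
  have "path_word P @ [(c, ?k), (\<not> c, count_list P (\<not> c))] @ [(c, ?k)] \<approx> path_word P @ [(c, ?k)]"
    by (rule path_word_absorb_of_corner[OF d]) auto
  then show ?case by (intro exI[of _ c]) (auto intro: eqv_sym)
qed

lemma path_word_absorb:
  assumes "count_list P c \<le> k" "levels_within ((count_list P)(c := k)) x"
  shows "path_word P @ x @ [(c, k)] \<approx> path_word P @ [(c, k)]"
  using path_word_corner[of P] path_word_absorb_of_corner[OF _ assms] by blast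

lemma path_word_replicate:
  "path_word (P @ replicate (Suc k) b) \<approx> path_word P @ [(b, Suc (count_list P b + k))]"
proof (induction k)
  case (Suc k)
  let ?m = "Suc (count_list P b + k)"
  have split: "P @ replicate (Suc (Suc k)) b = (P @ replicate (Suc k) b) @ [b]"
    by (simp add: replicate_append_same)
  have last: "Suc (count_list (P @ replicate (Suc k) b) b) = Suc ?m"
    by simp
  have "path_word (P @ replicate (Suc k) b) @ [(b, Suc ?m)] \<approx> (path_word P @ [(b, ?m)]) @ [(b, Suc ?m)]"
    using Suc by (rule eqv_suffix)
  moreover have "(path_word P @ [(b, ?m)]) @ [(b, Suc ?m)] \<approx> path_word P @ [(b, Suc ?m)]"
    using eqv_prefix[OF merge[of b ?m "Suc ?m"], of "path_word P"] by (simp add: max_def)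
  ultimately have "path_word (P @ replicate (Suc k) b) @ [(b, Suc ?m)] \<approx> path_word P @ [(b, Suc ?m)]"
    by (rule eqv_trans)
  then show ?case
    unfolding split path_word_snoc last by (simp only: add_Suc_right)
qed (simp add: eqv_refl)

text \<open>A letter that sets a new record swallows the part of the word before it, so that tracing the record
path before the word changes nothing.\<close>

lemma path_word_records_prefix: "path_word (records w) @ w \<approx> w"
proof (induction w rule: rev_induct)
  case (snoc l w)
  obtain b k where l: "l = (b, k)" by force
  let ?P = "records w"
  have IH: "path_word ?P @ w @ [l] \<approx> w @ [l]"
    using eqv_suffix[OF snoc] by simp
  show ?case
  proof (cases "k \<le> count_list ?P b")
    case True
    then show ?thesis using IH by (simp add: records_snoc l push_back_def)
  next
    case False
    then obtain j where j: "k = Suc (count_list ?P b + j)"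
      using less_imp_Suc_add[of "count_list ?P b" k] by auto
    then have diff: "k - count_list ?P b = Suc j" by simp
    have lw: "levels_within ((count_list ?P)(b := k)) w"
      using levels_within_records by (rule levels_within_mono) (use False in auto)
    have "path_word (records (w @ [l])) @ w @ [l] \<approx> (path_word ?P @ [l]) @ w @ [l]"
      using eqv_suffix[OF path_word_replicate[of ?P j b], of "w @ [l]"]
      by (simp add: records_snoc push_back_def l diff j[symmetric] del: replicate_Suc)
    also have "\<dots> \<approx> path_word ?P @ [l]"
      using path_word_absorb[of ?P b k "l # w"] False lw by (simp add: l)
    also have "\<dots> \<approx> path_word ?P @ w @ [l]"
      using eqv_sym[OF path_word_absorb[of ?P b k w]] False lw by (simp add: l)
    also have "\<dots> \<approx> w @ [l]" by (rule IH)
    finally show ?thesis .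
  qed
qed (simp add: eqv_refl)

lemma word_congruence_rev: "word_congruence (\<lambda>u v. rev u \<approx> rev v)"
proof
  show "equivp (\<lambda>u v. rev u \<approx> rev v)"
    by (intro equivpI reflpI sympI transpI) (auto intro: eqv_refl eqv_sym eqv_trans)
  show "rev (x @ u @ y) \<approx> rev (x @ v @ y)" if "rev u \<approx> rev v" for u v x y
    using eqv_context[OF that, of "rev y" "rev x"] by simp
  show "rev [(b, s), (b, t)] \<approx> rev [(b, max s t)]" for b s t
    using merge[of b t s] by (simp add: max.commute)
  show "rev [(b, 0)] \<approx> rev []" for b
    using level_zero by simp
  show "rev ([(b, m b)] @ x @ [(\<not> b, m (\<not> b))]) \<approx> rev [(b, m b), (\<not> b, m (\<not> b))]"
    if "levels_within m x" for b m x
    using sandwich[of m "rev x" "\<not> b"] that by simp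
qed

text \<open>Put the record path before \<open>w\<close> and its mirror image behind \<open>w\<close>. The copy of \<open>w\<close> in the middle is now
enclosed between letters of the two top levels and disappears by sandwiching.\<close>

lemma normal_form: "w \<approx> path_word (records w) @ rev (path_word (records (rev w)))"
proof -
  let ?P = "path_word (records w)" and ?Q = "path_word (records (rev w))"
  let ?m = "count_list (records w)"
  interpret R: word_congruence "\<lambda>u v. rev u \<approx> rev v"
    by (rule word_congruence_rev)
  have m: "count_list (records (rev w)) = ?m"
    by (rule ext) (rule count_list_records_rev)
  obtain d where corner: "rev ?Q \<approx> [(d, ?m d), (\<not> d, ?m (\<not> d))] @ rev ?Q"
    using R.path_word_corner[of "records (rev w)"] by (auto simp: m)
  have absorb: "?P @ w @ [(d, ?m d)] \<approx> ?P @ [(d, ?m d)]"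
    by (rule path_word_absorb) (simp_all add: levels_within_records)
  have "w \<approx> w @ rev ?Q"
    using eqv_sym[OF R.path_word_records_prefix[of "rev w"]] by simp
  also have "\<dots> \<approx> ?P @ w @ rev ?Q"
    using eqv_sym[OF eqv_suffix[OF path_word_records_prefix, of w "rev ?Q"]] by simp
  also have "\<dots> \<approx> (?P @ w @ [(d, ?m d)]) @ [(\<not> d, ?m (\<not> d))] @ rev ?Q"
    using eqv_prefix[OF corner, of "?P @ w"] by simp
  also have "\<dots> \<approx> (?P @ [(d, ?m d)]) @ [(\<not> d, ?m (\<not> d))] @ rev ?Q"
    using absorb by (rule eqv_suffix)
  also have "\<dots> \<approx> ?P @ rev ?Q"
    using eqv_sym[OF eqv_prefix[OF corner, of ?P]] by simp
  finally show ?thesis .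
qed

lemma eqv_if_same_records:
  "records v = records w \<Longrightarrow> records (rev v) = records (rev w) \<Longrightarrow> v \<approx> w"
  by (rule eqv_trans[OF normal_form[of v]]) (simp add: eqv_sym[OF normal_form[of w]])

end

section \<open>Towers of topologies\<close>

locale topology_tower =
  fixes X :: "'a set" and \<tau> :: "nat \<Rightarrow> 'a topology"
  assumes topspace_tower: "topspace (\<tau> s) = X"
    and coarser: "s \<le> t \<Longrightarrow> openin (\<tau> t) U \<Longrightarrow> openin (\<tau> s) U"
    and discrete: "\<tau> 0 = discrete_topology X"
begin

definition letter_op :: "letter \<Rightarrow> 'a set \<Rightarrow> 'a set" where
  "letter_op l A = (if fst l then \<tau> (snd l) closure_of A else \<tau> (snd l) interior_of A)"

abbreviation word_op :: "letter list \<Rightarrow> 'a set \<Rightarrow> 'a set" where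
  "word_op w \<equiv> fold letter_op w"

lemma letter_op_subset: "letter_op l A \<subseteq> X"
  using closure_of_subset_topspace[of "\<tau> (snd l)" A] interior_of_subset_topspace[of "\<tau> (snd l)" A]
  by (auto simp: letter_op_def topspace_tower)

lemma word_op_subset: "A \<subseteq> X \<Longrightarrow> word_op w A \<subseteq> X"
  by (induction w arbitrary: A) (simp_all add: letter_op_subset)

lemma letter_op_mono: "A \<subseteq> B \<Longrightarrow> letter_op l A \<subseteq> letter_op l B"
  by (simp add: letter_op_def closure_of_mono interior_of_mono)

lemma closure_extensive: "A \<subseteq> X \<Longrightarrow> A \<subseteq> letter_op (True, s) A"
  by (simp add: letter_op_def closure_of_subset topspace_tower)

lemma interior_contractive: "letter_op (False, s) A \<subseteq> A"
  by (simp add: letter_op_def interior_of_subset)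

lemma closedin_coarser: "s \<le> t \<Longrightarrow> closedin (\<tau> t) C \<Longrightarrow> closedin (\<tau> s) C"
  by (simp add: closedin_def topspace_tower coarser)

lemma closure_level_mono: "A \<subseteq> X \<Longrightarrow> s \<le> t \<Longrightarrow> letter_op (True, s) A \<subseteq> letter_op (True, t) A"
  by (simp add: letter_op_def closure_of_minimal closure_of_subset closedin_coarser topspace_tower)

lemma interior_level_mono: "s \<le> t \<Longrightarrow> letter_op (False, t) A \<subseteq> letter_op (False, s) A"
  by (simp add: letter_op_def interior_of_maximal interior_of_subset coarser)

lemma letter_op_level_zero: "A \<subseteq> X \<Longrightarrow> letter_op (b, 0) A = A"
  by (simp add: letter_op_def discrete discrete_topology_closure_of
      interior_of_openin openin_discrete_topology inf.absorb2)

text \<open>A set closed in the coarser topology is closed in the finer one, so of two successive closures the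
coarser one wins; dually for interiors.\<close>

lemma letter_op_merge:
  assumes "A \<subseteq> X"
  shows "letter_op (b, s) (letter_op (b, t) A) = letter_op (b, max s t) A"
proof (cases b)
  case True
  have "letter_op (True, s) (letter_op (True, t) A) = letter_op (True, max s t) A"
  proof (cases "s \<le> t")
    case True
    then show ?thesis
      by (simp add: letter_op_def closure_of_closedin closedin_coarser max_def)
  next
    case False
    then have "letter_op (True, s) (letter_op (True, t) A) \<subseteq> letter_op (True, s) (letter_op (True, s) A)"
      by (intro letter_op_mono closure_level_mono assms) simp
    also have "\<dots> = letter_op (True, s) A" by (simp add: letter_op_def)
    finally show ?thesis
      using False letter_op_mono[OF closure_extensive[OF assms]] by (simp add: max_def antisym)
  qed
  then show ?thesis using True by simp
next
  case b: False
  have "letter_op (False, s) (letter_op (False, t) A) = letter_op (False, max s t) A"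
  proof (cases "s \<le> t")
    case True
    then show ?thesis
      by (simp add: letter_op_def interior_of_openin coarser max_def)
  next
    case False
    have "letter_op (False, s) A = letter_op (False, s) (letter_op (False, s) A)"
      by (simp add: letter_op_def)
    also have "\<dots> \<subseteq> letter_op (False, s) (letter_op (False, t) A)"
      by (intro letter_op_mono interior_level_mono) (use False in simp)
    finally show ?thesis
      using False letter_op_mono[OF interior_contractive] by (simp add: max_def antisym)
  qed
  then show ?thesis using b by simp
qed

lemma word_op_bounds:
  assumes "A \<subseteq> X" "levels_within m w"
  shows "letter_op (False, m False) A \<subseteq> word_op w A" "word_op w A \<subseteq> letter_op (True, m True) A"
  using assms(2)
proof (induction w rule: rev_induct)
  case Nil
  {
    case 1
    show ?case by (simp add: interior_contractive)
  next
    case 2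
    show ?case using assms by (simp add: closure_extensive)
  }
next
  case (snoc l w)
  obtain b s where l: "l = (b, s)" by force
  {
    case 1
    then have "letter_op (False, m False) A \<subseteq> word_op w A" by (intro snoc) simp
    from letter_op_mono[OF this, of l]
    have *: "letter_op l (letter_op (False, m False) A) \<subseteq> word_op (w @ [l]) A" by simp
    show ?case
    proof (cases b)
      case True
      then show ?thesis using * closure_extensive[OF letter_op_subset] by (fastforce simp: l)
    next
      case False
      then show ?thesis using * 1 assms by (simp add: l letter_op_merge max_absorb2)
    qed
  next
    case 2
    then have "word_op w A \<subseteq> letter_op (True, m True) A" by (intro snoc) simp
    from letter_op_mono[OF this, of l]
    have *: "word_op (w @ [l]) A \<subseteq> letter_op l (letter_op (True, m True) A)" by simp
    show ?case
    proof (cases b)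
      case False
      then show ?thesis using * interior_contractive by (fastforce simp: l)
    next
      case True
      then show ?thesis using * 2 assms by (simp add: l letter_op_merge max_absorb2)
    qed
  }
qed

lemma letter_op_idem: "A \<subseteq> X \<Longrightarrow> letter_op l (letter_op l A) = letter_op l A"
  by (cases l) (simp add: letter_op_merge)

lemma word_op_sandwich:
  assumes A: "A \<subseteq> X" and w: "levels_within m w"
  shows "letter_op (\<not> b, m (\<not> b)) (word_op w (letter_op (b, m b) A)) =
    letter_op (\<not> b, m (\<not> b)) (letter_op (b, m b) A)"
proof -
  let ?l = "(b, m b)" and ?l' = "(\<not> b, m (\<not> b))"
  let ?B = "letter_op ?l A"
  have B: "?B \<subseteq> X" by (rule letter_op_subset)
  have 1: "letter_op ?l' (letter_op ?l ?B) = letter_op ?l' ?B"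
    using A by (simp add: letter_op_idem)
  have 2: "letter_op ?l' (letter_op ?l' ?B) = letter_op ?l' ?B"
    using B by (rule letter_op_idem)
  note bounds = word_op_bounds[OF B w, THEN letter_op_mono[of _ _ ?l']]
  show ?thesis
    by (cases b) (use bounds 1 2 in auto)
qed

sublocale word_congruence "\<lambda>u v. \<forall>A\<subseteq>X. word_op u A = word_op v A"
proof
  show "equivp (\<lambda>u v. \<forall>A\<subseteq>X. word_op u A = word_op v A)"
    by (intro equivpI reflpI sympI transpI) auto
  show "\<forall>A\<subseteq>X. word_op [(b, s), (b, t)] A = word_op [(b, max s t)] A" for b s t
    by (simp add: letter_op_merge max.commute)
  show "\<forall>A\<subseteq>X. word_op (x @ u @ y) A = word_op (x @ v @ y) A"
    if "\<forall>A\<subseteq>X. word_op u A = word_op v A" for u v x y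
    using that by (simp add: word_op_subset)
  show "\<forall>A\<subseteq>X. word_op [(b, 0)] A = word_op [] A" for b
    by (simp add: letter_op_level_zero)
  show "\<forall>A\<subseteq>X. word_op ([(b, m b)] @ x @ [(\<not> b, m (\<not> b))]) A =
      word_op [(b, m b), (\<not> b, m (\<not> b))] A"
    if "levels_within m x" for b m x
    using word_op_sandwich[OF _ that] by simp
qed

definition word_map :: "letter list \<Rightarrow> 'a set \<Rightarrow> 'a set" where
  "word_map w = (\<lambda>A\<in>Pow X. word_op w A)"

lemma word_map_eqI:
  "records v = records w \<Longrightarrow> records (rev v) = records (rev w) \<Longrightarrow> word_map v = word_map w"
  using eqv_if_same_records[of v w] unfolding word_map_def by (intro restrict_ext) blast

lemma word_map_append: "word_map (v @ w) = compose (Pow X) (word_map w) (word_map v)"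
  unfolding word_map_def compose_def by (rule restrict_ext) (simp add: word_op_subset)

lemma word_map_in_carrier: "word_map w \<in> Pow X \<rightarrow>\<^sub>E Pow X"
  by (rule PiE_I) (simp_all add: word_map_def word_op_subset)

lemma word_op_empty: "word_op w {} = {}"
  by (induction w) (simp_all add: letter_op_def)

lemma letter_op_complement: "letter_op (b, s) (X - A) = X - letter_op (\<not> b, s) A"
  using closure_of_complement[of "\<tau> s" A] interior_of_complement[of "\<tau> s" A]
  by (simp add: letter_op_def topspace_tower)

text \<open>The word that results when a complement is moved past the given one.\<close>

definition dual_word :: "letter list \<Rightarrow> letter list" where
  "dual_word = map (\<lambda>l. (\<not> fst l, snd l))"

lemma word_op_complement: "word_op w (X - A) = X - word_op (dual_word w) A"
proof (induction w arbitrary: A)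
  case (Cons l w)
  then show ?case by (cases l) (simp add: dual_word_def letter_op_complement)
qed (simp add: dual_word_def)

lemma levels_within_dual: "levels_within (\<lambda>_. n) w \<Longrightarrow> levels_within (\<lambda>_. n) (dual_word w)"
  by (simp add: levels_within_def dual_word_def)

definition co_word_map :: "letter list \<Rightarrow> 'a set \<Rightarrow> 'a set" where
  "co_word_map w = (\<lambda>A\<in>Pow X. X - word_op w A)"

lemma co_word_map_in_carrier: "co_word_map w \<in> Pow X \<rightarrow>\<^sub>E Pow X"
  by (rule PiE_I) (auto simp: co_word_map_def)

lemma compose_co_word_map:
  "compose (Pow X) (co_word_map w) (word_map v) = co_word_map (v @ w)"
  "compose (Pow X) (word_map w) (co_word_map v) = co_word_map (v @ dual_word w)"
  "compose (Pow X) (co_word_map w) (co_word_map v) = word_map (v @ dual_word w)"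
  unfolding word_map_def co_word_map_def compose_def
  by (rule restrict_ext, simp add: word_op_subset word_op_complement double_diff)+

section \<open>The monoids as sets of words\<close>

lemma submonoid_generated_eqI:
  assumes "submonoid M G" "S \<subseteq> M" "\<And>H. submonoid H G \<Longrightarrow> S \<subseteq> H \<Longrightarrow> M \<subseteq> H"
  shows "submonoid_generated G S = M"
  unfolding submonoid_generated_def using assms by blast

abbreviation bounded_words :: "nat \<Rightarrow> letter list set" where
  "bounded_words n \<equiv> {w. levels_within (\<lambda>_. n) w}"

lemma word_map_Nil: "word_map [] = (\<lambda>A\<in>Pow X. A)"
  by (simp add: word_map_def)

lemma powerset_maps_simps:
  "carrier (powerset_maps X) = Pow X \<rightarrow>\<^sub>E Pow X"
  "f \<otimes>\<^bsub>powerset_maps X\<^esub> g = compose (Pow X) f g"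
  "\<one>\<^bsub>powerset_maps X\<^esub> = word_map []"
  by (simp_all add: powerset_maps_def word_map_Nil)

lemma word_map_closure: "word_map [(True, s)] = closure_map X (\<tau> s)"
  by (simp add: word_map_def closure_map_def letter_op_def)

lemma word_map_interior: "word_map [(False, s)] = interior_map X (\<tau> s)"
  by (simp add: word_map_def interior_map_def letter_op_def)

lemma word_map_level_zero: "word_map [(b, 0)] = word_map []"
  unfolding word_map_def by (rule restrict_ext) (simp add: letter_op_level_zero)

text \<open>Only levels from \<open>1\<close> to \<open>n\<close> have to be provided: a letter of level \<open>0\<close> is the identity.\<close>

lemma word_map_mem_submonoid:
  assumes H: "submonoid H (powerset_maps X)"
    and letters: "\<And>b s. 0 < s \<Longrightarrow> s \<le> n \<Longrightarrow> word_map [(b, s)] \<in> H"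
    and w: "levels_within (\<lambda>_. n) w"
  shows "word_map w \<in> H"
  using w
proof (induction w)
  case Nil
  show ?case using submonoid.one_closed[OF H] unfolding powerset_maps_simps .
next
  case (Cons l w)
  obtain b s where l: "l = (b, s)" by force
  from Cons have IH: "word_map w \<in> H" by simp
  show ?case
  proof (cases "s = 0")
    case True
    then show ?thesis
      using IH word_map_append[of "[l]" w] word_map_append[of "[]" w] by (simp add: l word_map_level_zero)
  next
    case False
    then have "word_map [l] \<in> H" using Cons.prems by (simp add: l letters)
    from submonoid.m_closed[OF H IH this] show ?thesis
      using word_map_append[of "[l]" w] by (simp add: powerset_maps_simps)
  qed
qed

lemma kuratowski_monoid_eq:
  "kuratowski_monoid n X (\<lambda>i. \<tau> (n - i)) = word_map ` bounded_words n"
  unfolding kuratowski_monoid_def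
proof (rule submonoid_generated_eqI)
  show "submonoid (word_map ` bounded_words n) (powerset_maps X)"
  proof
    show "word_map ` bounded_words n \<subseteq> carrier (powerset_maps X)"
      unfolding powerset_maps_simps using word_map_in_carrier by blast
    show "\<one>\<^bsub>powerset_maps X\<^esub> \<in> word_map ` bounded_words n"
      unfolding powerset_maps_simps by (rule imageI) simp
    show "f \<otimes>\<^bsub>powerset_maps X\<^esub> g \<in> word_map ` bounded_words n"
      if fg: "f \<in> word_map ` bounded_words n" "g \<in> word_map ` bounded_words n" for f g
    proof -
      obtain v w where "levels_within (\<lambda>_. n) (w @ v)" "f = word_map v" "g = word_map w"
        using fg by auto
      then show ?thesis
        by (intro image_eqI[of _ _ "w @ v"]) (simp_all add: powerset_maps_simps word_map_append)
    qed
  qed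
  have letter: "word_map [(b, n - i)] \<in> word_map ` bounded_words n" for b i
    by (rule imageI) simp
  show "(\<lambda>i. interior_map X (\<tau> (n - i))) ` {..<n} \<union> (\<lambda>i. closure_map X (\<tau> (n - i))) ` {..<n}
      \<subseteq> word_map ` bounded_words n"
    using letter[of False] letter[of True] by (auto simp: word_map_closure word_map_interior)
  show "word_map ` bounded_words n \<subseteq> H"
    if H: "submonoid H (powerset_maps X)"
      and gen: "(\<lambda>i. interior_map X (\<tau> (n - i))) ` {..<n} \<union> (\<lambda>i. closure_map X (\<tau> (n - i))) ` {..<n} \<subseteq> H"
    for H
  proof -
    have "word_map [(b, s)] \<in> H" if "0 < s" "s \<le> n" for b s
    proof -
      have "n - s \<in> {..<n}" "n - (n - s) = s" using that by auto
      then show ?thesis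
        using gen by (cases b) (force simp: word_map_closure word_map_interior)+
    qed
    then show ?thesis using word_map_mem_submonoid[OF H] by blast
  qed
qed

lemma full_kuratowski_monoid_eq:
  "full_kuratowski_monoid n X (\<lambda>i. \<tau> (n - i)) =
     word_map ` bounded_words n \<union> co_word_map ` bounded_words n"  (is "_ = ?M")
  unfolding full_kuratowski_monoid_def
proof (rule submonoid_generated_eqI)
  show "submonoid ?M (powerset_maps X)"
  proof
    show "?M \<subseteq> carrier (powerset_maps X)"
      unfolding powerset_maps_simps using word_map_in_carrier co_word_map_in_carrier by blast
    have "word_map [] \<in> ?M" by (intro UnI1 imageI) simp
    then show "\<one>\<^bsub>powerset_maps X\<^esub> \<in> ?M"
      unfolding powerset_maps_simps .
    show "f \<otimes>\<^bsub>powerset_maps X\<^esub> g \<in> ?M" if fg: "f \<in> ?M" "g \<in> ?M" for f g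
    proof -
      obtain v w where vw: "levels_within (\<lambda>_. n) v" "levels_within (\<lambda>_. n) w"
        and f: "f = word_map v \<or> f = co_word_map v" and g: "g = word_map w \<or> g = co_word_map w"
        using fg by blast
      have mem: "word_map (w @ v) \<in> ?M" "co_word_map (w @ v) \<in> ?M"
        "word_map (w @ dual_word v) \<in> ?M" "co_word_map (w @ dual_word v) \<in> ?M"
        using vw by (simp_all add: levels_within_dual)
      have "compose (Pow X) f g \<in> ?M"
        using f g mem by (elim disjE) (simp_all only: word_map_append[symmetric] compose_co_word_map)
      then show ?thesis by (simp add: powerset_maps_simps)
    qed
  qed
  have letter: "word_map [(True, n - i)] \<in> ?M" for i
    by (intro UnI1 imageI) simp
  have complement: "complement_map X = co_word_map []"
    by (simp add: complement_map_def co_word_map_def)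
  have "co_word_map [] \<in> ?M" by (intro UnI2 imageI) simp
  then show "insert (complement_map X) ((\<lambda>i. closure_map X (\<tau> (n - i))) ` {..<n}) \<subseteq> ?M"
    using letter by (auto simp: word_map_closure complement simp del: Un_iff)
  show "?M \<subseteq> H"
    if H: "submonoid H (powerset_maps X)"
      and gen: "insert (complement_map X) ((\<lambda>i. closure_map X (\<tau> (n - i))) ` {..<n}) \<subseteq> H" for H
  proof -
    have mult: "compose (Pow X) f g \<in> H" if "f \<in> H" "g \<in> H" for f g
      using submonoid.m_closed[OF H that] by (simp add: powerset_maps_simps)
    have co: "co_word_map [] \<in> H" using gen by (simp add: complement)
    have closure: "word_map [(True, s)] \<in> H" if "0 < s" "s \<le> n" for s
    proof -
      have "n - s \<in> {..<n}" "n - (n - s) = s" using that by auto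
      then show ?thesis using gen by (force simp: word_map_closure)
    qed
    have interior: "word_map [(False, s)] \<in> H" if "0 < s" "s \<le> n" for s
    proof -
      have "compose (Pow X) (co_word_map []) (compose (Pow X) (word_map [(True, s)]) (co_word_map [])) \<in> H"
        by (intro mult co closure that)
      then show ?thesis by (simp add: compose_co_word_map dual_word_def)
    qed
    have words: "word_map w \<in> H" if "w \<in> bounded_words n" for w
    proof (rule word_map_mem_submonoid[OF H])
      show "word_map [(b, s)] \<in> H" if "0 < s" "s \<le> n" for b s
        using that closure interior by (cases b) auto
    qed (use that in simp)
    moreover have "co_word_map w \<in> H" if "w \<in> bounded_words n" for w
      using mult[OF co words[OF that]] by (simp add: compose_co_word_map)
    ultimately show ?thesis by blast
  qed
qed

lemma card_co_word_map:
  "card (co_word_map ` S) = card (word_map ` S)"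
proof -
  let ?h = "\<lambda>f. \<lambda>A\<in>Pow X. X - f A"
  have image: "co_word_map ` S = ?h ` word_map ` S"
    unfolding image_image co_word_map_def word_map_def
    by (intro image_cong refl restrict_ext) simp
  have "?h (?h (word_map w)) = word_map w" for w
    unfolding word_map_def by (rule restrict_ext) (simp add: double_diff word_op_subset)
  then have "inj_on ?h (word_map ` S)"
    by (intro inj_on_inverseI[of _ ?h]) blast
  then show ?thesis unfolding image by (rule card_image)
qed

text \<open>A word operator fixes the empty set, and its complement sends it to \<open>X\<close>.\<close>

lemma word_map_co_word_map_disjoint:
  assumes "X \<noteq> {}"
  shows "word_map ` S \<inter> co_word_map ` S' = {}"
proof -
  have "word_map v \<noteq> co_word_map w" for v w
  proof
    assume "word_map v = co_word_map w"
    from fun_cong[OF this, of "{}"] show False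
      using assms by (simp add: word_map_def co_word_map_def word_op_empty)
  qed
  then show ?thesis by auto
qed

end

section \<open>Posets with closure and interior operators\<close>

text \<open>For reflexive and transitive \<open>R\<close> this is the Alexandrov topology of \<open>R\<close>, in which \<open>{b. R a b}\<close> is
the least neighbourhood of \<open>a\<close>.\<close>

definition relation_topology :: "'a set \<Rightarrow> ('a \<Rightarrow> 'a \<Rightarrow> bool) \<Rightarrow> 'a topology" where
  "relation_topology X R = topology (\<lambda>U. U \<subseteq> X \<and> (\<forall>a\<in>U. \<forall>b\<in>X. R a b \<longrightarrow> b \<in> U))"

lemma openin_relation_topology:
  "openin (relation_topology X R) U \<longleftrightarrow> U \<subseteq> X \<and> (\<forall>a\<in>U. \<forall>b\<in>X. R a b \<longrightarrow> b \<in> U)"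
proof -
  have "istopology (\<lambda>U. U \<subseteq> X \<and> (\<forall>a\<in>U. \<forall>b\<in>X. R a b \<longrightarrow> b \<in> U))"
    unfolding istopology_def by blast
  then show ?thesis by (simp add: relation_topology_def)
qed

lemma topspace_relation_topology: "topspace (relation_topology X R) = X"
  unfolding topspace_def openin_relation_topology by blast

lemma interior_of_relation_topology:
  assumes refl: "\<And>a. R a a" and trans: "\<And>a b c. R a b \<Longrightarrow> R b c \<Longrightarrow> R a c"
  shows "relation_topology X R interior_of A = {a \<in> X. \<forall>b\<in>X. R a b \<longrightarrow> b \<in> A}"
proof
  show "relation_topology X R interior_of A \<subseteq> {a \<in> X. \<forall>b\<in>X. R a b \<longrightarrow> b \<in> A}"
    unfolding interior_of_def openin_relation_topology by blast
  have "openin (relation_topology X R) {a \<in> X. \<forall>b\<in>X. R a b \<longrightarrow> b \<in> A}"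
    unfolding openin_relation_topology using trans by blast
  then show "{a \<in> X. \<forall>b\<in>X. R a b \<longrightarrow> b \<in> A} \<subseteq> relation_topology X R interior_of A"
    by (intro interior_of_maximal) (use refl in blast)
qed

lemma closure_of_relation_topology:
  assumes refl: "\<And>a. R a a" and trans: "\<And>a b c. R a b \<Longrightarrow> R b c \<Longrightarrow> R a c"
  shows "relation_topology X R closure_of A = {a \<in> X. \<exists>b\<in>X. R a b \<and> b \<in> A}"
  using interior_of_relation_topology[of R X "X - A", OF assms]
  unfolding closure_of_interior_of topspace_relation_topology by auto

locale closure_interior_poset =
  fixes W :: "'w set" and le :: "'w \<Rightarrow> 'w \<Rightarrow> bool" (infix "\<preceq>" 50)
    and act :: "letter \<Rightarrow> 'w \<Rightarrow> 'w" and n :: nat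
  assumes le_refl: "u \<preceq> u"
    and le_trans: "u \<preceq> v \<Longrightarrow> v \<preceq> w \<Longrightarrow> u \<preceq> w"
    and le_antisym: "u \<preceq> v \<Longrightarrow> v \<preceq> u \<Longrightarrow> u = v"
    and act_mono: "u \<preceq> v \<Longrightarrow> act l u \<preceq> act l v"
    and act_extensive: "u \<preceq> act (True, s) u"
    and act_contractive: "act (False, s) u \<preceq> u"
    and act_merge: "act (b, s) (act (b, t) u) = act (b, max s t) u"
    and act_level_zero: "act (b, 0) u = u"
    and act_closed: "u \<in> W \<Longrightarrow> snd l \<le> n \<Longrightarrow> act l u \<in> W"
begin

definition up_sets :: "'w set set" where
  "up_sets = {F. F \<subseteq> W \<and> (\<forall>u\<in>F. \<forall>v\<in>W. u \<preceq> v \<longrightarrow> v \<in> F)}"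

lemma fixed_mono: "act (b, t) u = u \<Longrightarrow> s \<le> t \<Longrightarrow> act (b, s) u = u"
  by (metis act_merge max.absorb2)

lemma act_idem: "act (b, s) (act (b, s) u) = act (b, s) u"
  by (simp add: act_merge)

end

text \<open>Any indexing of the up-sets may serve as the set of points, so that the points can be taken to be
natural numbers.\<close>

locale up_set_space = closure_interior_poset W le act n
  for W :: "'w set" and le (infix "\<preceq>" 50) and act n +
  fixes X :: "'a set" and val :: "'a \<Rightarrow> 'w set"
  assumes val_bij: "bij_betw val X up_sets"
begin

text \<open>The relation says that \<open>b\<close> lies in every prescribed open set that contains \<open>a\<close>. The set representing
\<open>u\<close> is to be open if \<open>u\<close> is fixed by the interior operator of level \<open>s\<close>, and closed if \<open>u\<close> is fixed
by the closure operator of level \<open>s\<close>. Higher levels have fewer fixed points, hence more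
related pairs and a coarser topology; at level \<open>0\<close> all elements are fixed and the topology is discrete.\<close>

definition sees :: "nat \<Rightarrow> 'a \<Rightarrow> 'a \<Rightarrow> bool" where
  "sees s a b \<longleftrightarrow> (\<forall>u\<in>W. (act (False, s) u = u \<longrightarrow> u \<in> val a \<longrightarrow> u \<in> val b) \<and>
                       (act (True, s) u = u \<longrightarrow> u \<in> val b \<longrightarrow> u \<in> val a))"

definition level_topology :: "nat \<Rightarrow> 'a topology" where
  "level_topology s = relation_topology X (sees s)"

definition test_set :: "'w \<Rightarrow> 'a set" where
  "test_set w = {a \<in> X. w \<in> val a}"

lemma sees_refl: "sees s a a"
  by (simp add: sees_def)

lemma sees_trans: "sees s a b \<Longrightarrow> sees s b c \<Longrightarrow> sees s a c"
  unfolding sees_def by blast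

lemma sees_mono: "s \<le> t \<Longrightarrow> sees s a b \<Longrightarrow> sees t a b"
  unfolding sees_def using fixed_mono by blast

lemma val_up_set: "a \<in> X \<Longrightarrow> val a \<in> up_sets"
  using val_bij by (auto simp: bij_betw_def)

lemma val_surj:
  assumes "F \<in> up_sets"
  obtains a where "a \<in> X" "val a = F"
proof -
  have "F \<in> val ` X" using assms val_bij by (simp add: bij_betw_def)
  then show thesis using that by blast
qed

lemma sees_zero: "a \<in> X \<Longrightarrow> b \<in> X \<Longrightarrow> sees 0 a b \<longleftrightarrow> a = b"
proof
  assume ab: "a \<in> X" "b \<in> X" and "sees 0 a b"
  then have "\<forall>u\<in>W. u \<in> val a \<longleftrightarrow> u \<in> val b"
    by (auto simp: sees_def act_level_zero)
  moreover have "val a \<subseteq> W" "val b \<subseteq> W"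
    using ab val_up_set by (auto simp: up_sets_def)
  ultimately have "val a = val b" by blast
  then show "a = b"
    using ab val_bij by (auto simp: bij_betw_def inj_on_def)
qed (simp add: sees_refl)

sublocale topology_tower X level_topology
proof
  show "topspace (level_topology s) = X" for s
    by (simp add: level_topology_def topspace_relation_topology)
  show "openin (level_topology s) U" if "s \<le> t" "openin (level_topology t) U" for s t U
    using that sees_mono unfolding level_topology_def openin_relation_topology by blast
  show "level_topology 0 = discrete_topology X"
    unfolding topology_eq level_topology_def openin_relation_topology openin_discrete_topology
    using sees_zero by blast
qed

text \<open>If \<open>a\<close> does not contain the interior of \<open>w\<close>, the up-set generated by the interior-fixed elements of
\<open>a\<close> is a point in every neighbourhood of \<open>a\<close> that misses \<open>w\<close>.\<close>

lemma interior_test_set: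
  assumes w: "w \<in> W" and s: "s \<le> n"
  shows "level_topology s interior_of test_set w = test_set (act (False, s) w)"
proof -
  have "(\<forall>b\<in>X. sees s a b \<longrightarrow> w \<in> val b) \<longleftrightarrow> act (False, s) w \<in> val a" if a: "a \<in> X" for a
  proof
    assume mem: "act (False, s) w \<in> val a"
    have "act (False, s) w \<in> W" using w s by (simp add: act_closed)
    then show "\<forall>b\<in>X. sees s a b \<longrightarrow> w \<in> val b"
      using mem w act_contractive[of s w] act_idem[of False s w] val_up_set
      unfolding sees_def up_sets_def by blast
  next
    assume all: "\<forall>b\<in>X. sees s a b \<longrightarrow> w \<in> val b"
    let ?F = "{v \<in> W. \<exists>u\<in>val a. act (False, s) u = u \<and> u \<preceq> v}"
    have "?F \<in> up_sets" using le_trans unfolding up_sets_def by blast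
    then obtain b where b: "b \<in> X" "val b = ?F" by (rule val_surj)
    have "?F \<subseteq> val a" using val_up_set[OF a] unfolding up_sets_def by blast
    then have "sees s a b" using le_refl unfolding sees_def b by blast
    then obtain u where u: "u \<in> val a" "act (False, s) u = u" "u \<preceq> w"
      using all b by blast
    then have "u \<preceq> act (False, s) w" using act_mono[of u w "(False, s)"] by simp
    moreover have "act (False, s) w \<in> W" using w s by (simp add: act_closed)
    ultimately show "act (False, s) w \<in> val a"
      using u val_up_set[OF a] unfolding up_sets_def by blast
  qed
  then show ?thesis
    unfolding level_topology_def
    by (subst interior_of_relation_topology) (auto simp: test_set_def sees_refl intro: sees_trans)
qed

text \<open>If \<open>a\<close> contains the closure of \<open>w\<close>, then adding to \<open>a\<close> all elements above \<open>w\<close> brings in no new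
closure-fixed element, since such an element also lies above the closure of \<open>w\<close>. So the enlarged
up-set is a point in every neighbourhood of \<open>a\<close>, and it contains \<open>w\<close>.\<close>

lemma closure_test_set:
  assumes w: "w \<in> W" and s: "s \<le> n"
  shows "level_topology s closure_of test_set w = test_set (act (True, s) w)"
proof -
  have "(\<exists>b\<in>X. sees s a b \<and> w \<in> val b) \<longleftrightarrow> act (True, s) w \<in> val a" if a: "a \<in> X" for a
  proof
    assume "\<exists>b\<in>X. sees s a b \<and> w \<in> val b"
    then obtain b where b: "b \<in> X" "sees s a b" "w \<in> val b" by blast
    have W: "act (True, s) w \<in> W" using w s by (simp add: act_closed)
    then have "act (True, s) w \<in> val b"
      using b act_extensive[of w s] val_up_set unfolding up_sets_def by blast
    then show "act (True, s) w \<in> val a"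
      using b W act_idem[of True s w] unfolding sees_def by blast
  next
    assume mem: "act (True, s) w \<in> val a"
    let ?F = "val a \<union> {v \<in> W. w \<preceq> v}"
    have up: "val a \<in> up_sets" using a by (rule val_up_set)
    then have "?F \<in> up_sets" using le_trans unfolding up_sets_def by blast
    then obtain b where b: "b \<in> X" "val b = ?F" by (rule val_surj)
    have "v \<in> val a" if v: "v \<in> W" "w \<preceq> v" "act (True, s) v = v" for v
    proof -
      have "act (True, s) w \<preceq> v" using act_mono[OF v(2), of "(True, s)"] v(3) by simp
      then show ?thesis using up mem v(1) unfolding up_sets_def by blast
    qed
    then have "sees s a b" unfolding sees_def b by blast
    moreover have "w \<in> val b" using w le_refl b by blast
    ultimately show "\<exists>b\<in>X. sees s a b \<and> w \<in> val b" using b by blast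
  qed
  then show ?thesis
    unfolding level_topology_def
    by (subst closure_of_relation_topology) (auto simp: test_set_def sees_refl intro: sees_trans)
qed

lemma word_op_test_set:
  assumes "w \<in> W" "levels_within (\<lambda>_. n) v"
  shows "word_op v (test_set w) = test_set (fold act v w)"
  using assms
proof (induction v arbitrary: w)
  case (Cons l v)
  obtain b s where l: "l = (b, s)" by force
  have "letter_op l (test_set w) = test_set (act l w)"
    using Cons.prems by (cases b) (simp_all add: l letter_op_def closure_test_set interior_test_set)
  then show ?case using Cons.IH[of "act l w"] Cons.prems by (simp add: act_closed)
qed simp

text \<open>The principal up-set of \<open>u\<close> is a point that distinguishes \<open>u\<close> from all elements not above it.\<close>

lemma test_set_inj:
  assumes "u \<in> W" "v \<in> W" "test_set u = test_set v"
  shows "u = v"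
proof -
  have le: "u \<preceq> v" if W: "u \<in> W" "v \<in> W" and eq: "test_set u = test_set v" for u v
  proof -
    have "{w \<in> W. u \<preceq> w} \<in> up_sets" using le_trans unfolding up_sets_def by blast
    then obtain a where "a \<in> X" "val a = {w \<in> W. u \<preceq> w}" by (rule val_surj)
    then show ?thesis using eq W le_refl[of u] unfolding test_set_def by blast
  qed
  show ?thesis using le_antisym le assms by metis
qed

lemma word_map_eqD:
  assumes w: "w \<in> W" and v: "levels_within (\<lambda>_. n) v" "levels_within (\<lambda>_. n) v'"
    and eq: "word_map v = word_map v'"
  shows "fold act v w = fold act v' w"
proof -
  have closed: "fold act x w \<in> W" if "levels_within (\<lambda>_. n) x" for x
    using w that by (induction x arbitrary: w) (simp_all add: act_closed)
  have "test_set w \<subseteq> X" by (auto simp: test_set_def)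
  then have "word_op v (test_set w) = word_op v' (test_set w)"
    using fun_cong[OF eq, of "test_set w"] by (simp add: word_map_def)
  then show ?thesis
    using w v by (intro test_set_inj) (simp_all add: closed word_op_test_set)
qed

lemma space_nonempty: "X \<noteq> {}"
proof -
  have "{} \<in> up_sets" by (simp add: up_sets_def)
  then show ?thesis by (rule val_surj) blast
qed

end

section \<open>Two orders on lattice paths\<close>

text \<open>The order for paths that are extended at the end. Where two paths part, the one that turns in the
closure direction is larger; if one of them is a prefix of the other, the remaining steps must all be
of one kind. Paths like \<open>[]\<close> and \<open>[True, False]\<close> have to be incomparable: a closure of level \<open>2\<close>
turns them into \<open>[True, True]\<close> and \<open>[True, False, True]\<close>, of which the first is larger, whereas an
interior of level \<open>1\<close> turns them into \<open>[False]\<close> and \<open>[True, False]\<close>, of which the first is smaller.\<close>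

fun branch_le :: "bool list \<Rightarrow> bool list \<Rightarrow> bool" where
  "branch_le [] Q \<longleftrightarrow> False \<notin> set Q"
| "branch_le (a # P) [] \<longleftrightarrow> True \<notin> set (a # P)"
| "branch_le (a # P) (b # Q) \<longleftrightarrow> (if a = b then branch_le P Q else b)"

lemma branch_le_Nil: "branch_le P [] \<longleftrightarrow> True \<notin> set P"
  by (cases P) auto

lemma branch_le_refl: "branch_le P P"
  by (induction P) auto

lemma branch_le_antisym: "branch_le P Q \<Longrightarrow> branch_le Q P \<Longrightarrow> P = Q"
proof (induction P Q rule: branch_le.induct)
  case (1 Q)
  then show ?case by (cases Q) auto
next
  case (3 a P b Q)
  then show ?case by (cases a; cases b) auto
qed (auto split: if_splits)

lemma branch_le_only_True: "False \<notin> set P \<Longrightarrow> branch_le P Q \<Longrightarrow> False \<notin> set Q"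
  by (induction P Q rule: branch_le.induct) (auto split: if_splits)

lemma branch_le_only_False: "True \<notin> set Q \<Longrightarrow> branch_le P Q \<Longrightarrow> True \<notin> set P"
  by (induction P Q rule: branch_le.induct) (auto split: if_splits)

lemma branch_le_False_True: "True \<notin> set P \<Longrightarrow> False \<notin> set Q \<Longrightarrow> branch_le P Q"
  by (induction P Q rule: branch_le.induct) auto

lemma branch_le_trans: "branch_le P Q \<Longrightarrow> branch_le Q R \<Longrightarrow> branch_le P R"
proof (induction P Q arbitrary: R rule: branch_le.induct)
  case (1 Q)
  then show ?case using branch_le_only_True[of Q R] by simp
next
  case (2 a P)
  then have "True \<notin> set (a # P)" "False \<notin> set R" by simp_all
  then show ?case by (rule branch_le_False_True)
next
  case (3 a P b Q)
  show ?case
  proof (cases R)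
    case Nil
    have "True \<notin> set (b # Q)" using "3.prems"(2) unfolding Nil branch_le_Nil .
    then have "True \<notin> set (a # P)" using "3.prems"(1) by (rule branch_le_only_False)
    then show ?thesis using Nil by simp
  next
    case (Cons c S)
    then have le: "if a = b then branch_le P Q else b" "if b = c then branch_le Q S else c"
      using "3.prems" by simp_all
    have "branch_le P S" if "a = b" "b = c"
      using "3.IH" le that by simp
    then have "if a = c then branch_le P S else c"
      using le by (cases a; cases b; cases c) simp_all
    then show ?thesis using Cons by simp
  qed
qed

lemma branch_le_append: "branch_le P (P @ S) \<longleftrightarrow> False \<notin> set S"
  by (induction P) simp_all

lemma branch_append_le: "branch_le (P @ S) P \<longleftrightarrow> True \<notin> set S"
  by (induction P) (simp_all add: branch_le_Nil)

lemma branch_le_push_back_True: "branch_le P (push_back (True, k) P)"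
  by (simp add: push_back_def branch_le_append)

lemma branch_le_push_back_False: "branch_le (push_back (False, k) P) P"
  by (simp add: push_back_def branch_append_le)

lemma constant_list: "(\<not> b) \<notin> set Q \<Longrightarrow> \<exists>m. Q = replicate m b"
proof (intro exI[of _ "length Q"] replicate_eqI refl)
  show "y = b" if "(\<not> b) \<notin> set Q" "y \<in> set Q" for y
    using that by (cases y; cases b) simp_all
qed

text \<open>Paths that have parted stay so. If \<open>Q\<close> extends \<open>P\<close> by closure steps only, then pushing a closure of
level \<open>k\<close> extends both paths by closure steps up to the same level, or leaves \<open>Q\<close> ahead; pushing an
interior keeps \<open>P\<close> behind, as \<open>P\<close> then turns in the interior direction where \<open>Q\<close> turned in the other.
The case of a path \<open>P\<close> that extends \<open>Q\<close> by interior steps is dual.\<close>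

lemma branch_le_push_back:
  "branch_le P Q \<Longrightarrow> branch_le (push_back l P) (push_back l Q)"
proof -
  obtain b k where l: "l = (b, k)" by force
  have "branch_le (P @ replicate (k - count_list P b) b) (Q @ replicate (k - count_list Q b) b)"
    if "branch_le P Q"
    using that
  proof (induction P Q arbitrary: k rule: branch_le.induct)
    case (1 Q)
    then obtain m where Q: "Q = replicate m True" using constant_list[of True Q] by auto
    have "replicate m True @ replicate (k - m) True = replicate k True @ replicate (m - k) True"
      by (simp add: replicate_add[symmetric])
    then have "b \<Longrightarrow> ?case" by (simp add: Q branch_le_append)
    moreover have "\<not> b \<Longrightarrow> ?case"
      by (cases m; cases k) (simp_all add: Q branch_le_refl)
    ultimately show ?case by blast
  next
    case (2 a P)
    then obtain m where P: "a # P = replicate m False" using constant_list[of False "a # P"] by auto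
    have "replicate m False @ replicate (k - m) False = replicate k False @ replicate (m - k) False"
      by (simp add: replicate_add[symmetric])
    then have "\<not> b \<Longrightarrow> ?case" unfolding P by (simp add: branch_append_le)
    moreover have "b \<Longrightarrow> ?case"
      unfolding P by (cases m; cases k) (simp_all add: branch_le_Nil branch_le_refl)
    ultimately show ?case by blast
  next
    case (3 a P c Q)
    show ?case
    proof (cases "a = c")
      case True
      then have "branch_le P Q" using "3.prems" by simp
      moreover have "k - Suc (count_list P b) = k - 1 - count_list P b"
        "k - Suc (count_list Q b) = k - 1 - count_list Q b" by simp_all
      ultimately show ?thesis
        using "3.IH"[OF True, of k] "3.IH"[OF True, of "k - 1"] True by simp
    next
      case False
      then show ?thesis using "3.prems" by simp
    qed
  qed
  then show "branch_le P Q \<Longrightarrow> ?thesis" by (simp add: l push_back_def)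
qed

lemma push_back_merge: "push_back (b, s) (push_back (b, t) P) = push_back (b, max s t) P"
proof -
  have "(t - c) + (s - (c + (t - c))) = max s t - c" for c :: nat
    by linarith
  then show ?thesis by (simp add: push_back_def replicate_add[symmetric])
qed

text \<open>The order for paths that are changed at the front. The value \<open>profile Q y\<close> is the closure coordinate
at which the path leaves interior height \<open>y\<close>, or its final closure coordinate if it does not rise
above \<open>y\<close>. In these terms \<open>push_front\<close> is a pointwise operation: a closure of level \<open>k\<close> takes the
maximum with \<open>k\<close>, and an interior of level \<open>k\<close> replaces the values below height \<open>k\<close> by \<open>0\<close>.\<close>

primrec profile :: "bool list \<Rightarrow> nat \<Rightarrow> nat" where
  "profile [] y = 0"
| "profile (b # Q) y = (if b then Suc (profile Q y) else (case y of 0 \<Rightarrow> 0 | Suc z \<Rightarrow> profile Q z))"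

text \<open>The final height is compared as well, in the opposite direction, because the profile alone does not
determine it: \<open>[]\<close> and \<open>[False]\<close> have the same profile.\<close>

definition profile_le :: "bool list \<Rightarrow> bool list \<Rightarrow> bool" where
  "profile_le P Q \<longleftrightarrow> (\<forall>y. profile P y \<le> profile Q y) \<and> count_list Q False \<le> count_list P False"

lemma profile_le_trans:
  assumes "profile_le P Q" "profile_le Q R"
  shows "profile_le P R"
proof -
  have "profile P y \<le> profile R y" for y
    using assms le_trans[of "profile P y" "profile Q y" "profile R y"] by (simp add: profile_le_def)
  then show ?thesis using assms by (simp add: profile_le_def)
qed

lemma profile_push_front_True: "profile (push_front (True, k) Q) y = max k (profile Q y)"
proof -
  have "profile (replicate k True @ Q') y = k + profile Q' y" for k Q'
    by (induction k) auto
  moreover have "profile (strike k True Q) y = profile Q y - k"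
    by (induction Q arbitrary: k y) (auto split: nat.split)
  ultimately show ?thesis by (simp add: push_front_def max_def)
qed

lemma profile_push_front_False: "profile (push_front (False, k) Q) y = (if y < k then 0 else profile Q y)"
proof -
  have "profile (replicate k False @ Q') y = (if y < k then 0 else profile Q' (y - k))" for k Q'
    by (induction k arbitrary: y) (auto split: nat.split)
  moreover have "profile (strike k False Q) y = profile Q (y + k)" for y
  proof (induction Q arbitrary: k y)
    case (Cons c Q)
    then show ?case by (cases c; cases k) (auto split: nat.split)
  qed simp
  ultimately show ?thesis by (simp add: push_front_def)
qed

lemma profile_inj:
  "(\<And>y. profile P y = profile Q y) \<Longrightarrow> count_list P False = count_list Q False \<Longrightarrow> P = Q"
proof (induction P arbitrary: Q)
  case Nil
  then show ?case using Nil(1)[of 0] by (cases Q) (auto split: if_splits)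
next
  case (Cons a P)
  note eq = Cons.prems(1)
  have "profile P y = profile Q' y" if "Q = a # Q'" for Q' y
    using eq[of y] eq[of "Suc y"] that by (cases a) auto
  moreover have "\<exists>Q'. Q = a # Q'"
    using eq[of 0] Cons.prems(2) by (cases Q) (auto split: if_splits)
  ultimately show ?case using Cons.IH Cons.prems(2) by (auto split: if_splits)
qed

text \<open>Immediate on profiles, and a path is determined by its profile and its final height.\<close>

lemma push_front_merge: "push_front (b, s) (push_front (b, t) Q) = push_front (b, max s t) Q"
  by (rule profile_inj; cases b)
     (auto simp: profile_push_front_True profile_push_front_False count_list_push_front)

lemma profile_le_push_front: "profile_le P Q \<Longrightarrow> profile_le (push_front l P) (push_front l Q)"
  by (cases l; cases "fst l")
     (simp_all add: profile_le_def profile_push_front_True profile_push_front_False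
        count_list_push_front max.coboundedI2)

definition path_pair_le :: "bool list \<times> bool list \<Rightarrow> bool list \<times> bool list \<Rightarrow> bool" where
  "path_pair_le p q \<longleftrightarrow> branch_le (fst p) (fst q) \<and> profile_le (snd p) (snd q)"

definition path_pair_act :: "letter \<Rightarrow> bool list \<times> bool list \<Rightarrow> bool list \<times> bool list" where
  "path_pair_act l p = (push_back l (fst p), push_front l (snd p))"

definition paths_within :: "nat \<Rightarrow> bool list set" where
  "paths_within n = {P. \<forall>b. count_list P b \<le> n}"

text \<open>The first components carry the record path of a word, the second ones that of the reversed word. The
product order combines the two orders, so that one poset detects both paths.\<close>

lemma path_pair_poset:
  "closure_interior_poset (paths_within n \<times> paths_within n) path_pair_le path_pair_act n"
proof
  fix p q r :: "bool list \<times> bool list" and l :: letter and b s t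
  show "path_pair_le p p"
    by (simp add: path_pair_le_def branch_le_refl profile_le_def)
  show "path_pair_le p r" if "path_pair_le p q" "path_pair_le q r"
    using that branch_le_trans profile_le_trans unfolding path_pair_le_def by blast
  show "p = q" if "path_pair_le p q" "path_pair_le q p"
  proof (rule prod_eqI)
    show "fst p = fst q" using that by (simp add: path_pair_le_def branch_le_antisym)
    show "snd p = snd q"
      by (rule profile_inj) (use that in \<open>auto simp: path_pair_le_def profile_le_def intro: antisym\<close>)
  qed
  show "path_pair_le (path_pair_act l p) (path_pair_act l q)" if "path_pair_le p q"
    using that by (simp add: path_pair_le_def path_pair_act_def branch_le_push_back profile_le_push_front)
  show "path_pair_le p (path_pair_act (True, s) p)"
    by (simp add: path_pair_le_def path_pair_act_def branch_le_push_back_True profile_le_def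
        profile_push_front_True count_list_push_front)
  show "path_pair_le (path_pair_act (False, s) p) p"
    by (simp add: path_pair_le_def path_pair_act_def branch_le_push_back_False profile_le_def
        profile_push_front_False count_list_push_front)
  show "path_pair_act (b, s) (path_pair_act (b, t) p) = path_pair_act (b, max s t) p"
    by (simp add: path_pair_act_def push_back_merge push_front_merge)
  have "strike 0 b Q = Q" for Q by (induction Q) simp_all
  then show "path_pair_act (b, 0) p = p"
    by (simp add: path_pair_act_def push_back_def push_front_def)
  show "path_pair_act l p \<in> paths_within n \<times> paths_within n"
    if "p \<in> paths_within n \<times> paths_within n" "snd l \<le> n"
    using that by (cases l; cases p)
      (simp add: path_pair_act_def paths_within_def count_list_push_back count_list_push_front)
qed

lemma fold_path_pair_act: "fold path_pair_act w ([], []) = (records w, records (rev w))"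
proof -
  have "fold path_pair_act w p = (fold push_back w (fst p), fold push_front w (snd p))" for p
    by (induction w arbitrary: p) (simp_all add: path_pair_act_def)
  then show ?thesis by (simp add: fold_push_back fold_push_front)
qed

lemma finite_paths_within: "finite (paths_within n)"
proof (rule finite_subset)
  have "length P = count_list P True + count_list P False" for P
    by (induction P) auto
  moreover have "count_list P True + count_list P False \<le> n + n" if "P \<in> paths_within n" for P
    using that by (intro add_mono) (simp_all add: paths_within_def)
  ultimately show "paths_within n \<subseteq> {P. set P \<subseteq> UNIV \<and> length P \<le> n + n}"
    by auto
  show "finite {P. set P \<subseteq> (UNIV :: bool set) \<and> length P \<le> n + n}"
    by (rule finite_lists_length_le) simp
qed

section \<open>Counting lattice paths\<close>

definition paths_to :: "nat \<Rightarrow> nat \<Rightarrow> bool list set" where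
  "paths_to i j = {P. count_list P True = i \<and> count_list P False = j}"

lemma paths_to_Nil: "[] \<in> paths_to i j \<longleftrightarrow> i = 0 \<and> j = 0"
  by (auto simp: paths_to_def)

lemma paths_to_Cons:
  "b # P \<in> paths_to i j \<longleftrightarrow>
    (if b then \<exists>i'. i = Suc i' \<and> P \<in> paths_to i' j else \<exists>j'. j = Suc j' \<and> P \<in> paths_to i j')"
  by (auto simp: paths_to_def)

text \<open>Splitting off the first step gives Pascal's rule.\<close>

lemma card_paths_to: "finite (paths_to i j) \<and> card (paths_to i j) = (i + j choose i)"
proof (induction i arbitrary: j)
  case 0
  show ?case
  proof (induction j)
    case 0
    have "paths_to 0 0 = {[]}"
    proof (rule Set.set_eqI)
      show "P \<in> paths_to 0 0 \<longleftrightarrow> P \<in> {[]}" for P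
        by (cases P) (simp_all add: paths_to_Nil paths_to_Cons)
    qed
    then show ?case by simp
  next
    case (Suc j)
    have "paths_to 0 (Suc j) = Cons False ` paths_to 0 j"
    proof (rule Set.set_eqI)
      show "P \<in> paths_to 0 (Suc j) \<longleftrightarrow> P \<in> Cons False ` paths_to 0 j" for P
        by (cases P) (auto simp: paths_to_Nil paths_to_Cons split: if_splits)
    qed
    then show ?case using Suc by (simp add: card_image)
  qed
next
  case (Suc i)
  note IH = Suc
  show ?case
  proof (induction j)
    case 0
    have "paths_to (Suc i) 0 = Cons True ` paths_to i 0"
    proof (rule Set.set_eqI)
      show "P \<in> paths_to (Suc i) 0 \<longleftrightarrow> P \<in> Cons True ` paths_to i 0" for P
        by (cases P) (auto simp: paths_to_Nil paths_to_Cons split: if_splits)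
    qed
    then show ?case using IH[of 0] by (simp add: card_image)
  next
    case (Suc j)
    have "paths_to (Suc i) (Suc j) = Cons True ` paths_to i (Suc j) \<union> Cons False ` paths_to (Suc i) j"
    proof (rule Set.set_eqI)
      show "P \<in> paths_to (Suc i) (Suc j) \<longleftrightarrow>
          P \<in> Cons True ` paths_to i (Suc j) \<union> Cons False ` paths_to (Suc i) j" for P
        by (cases P) (auto simp: paths_to_Nil paths_to_Cons split: if_splits)
    qed
    moreover have "Cons True ` paths_to i (Suc j) \<inter> Cons False ` paths_to (Suc i) j = {}"
      by auto
    ultimately show ?case
      using Suc IH[of "Suc j"] by (simp add: card_Un_disjoint card_image)
  qed
qed

lemma card_path_pairs:
  "card {(P, Q). P \<in> paths_within n \<and> count_list P = count_list Q} = kuratowski_number n"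
proof -
  have count_eq: "count_list P = count_list Q \<longleftrightarrow>
      count_list P True = count_list Q True \<and> count_list P False = count_list Q False" for P Q
    by (simp add: fun_eq_iff all_bool_eq)
  have "{(P, Q). P \<in> paths_within n \<and> count_list P = count_list Q} =
      (\<Union>(i, j)\<in>{0..n} \<times> {0..n}. paths_to i j \<times> paths_to i j)"
    by (auto simp: count_eq paths_within_def all_bool_eq paths_to_def)
  also have "card \<dots> = (\<Sum>(i, j)\<in>{0..n} \<times> {0..n}. card (paths_to i j \<times> paths_to i j))"
  proof (subst card_UN_disjoint)
    show "\<forall>p\<in>{0..n} \<times> {0..n}. \<forall>q\<in>{0..n} \<times> {0..n}. p \<noteq> q \<longrightarrow>
        (case p of (i, j) \<Rightarrow> paths_to i j \<times> paths_to i j) \<inter>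
        (case q of (i, j) \<Rightarrow> paths_to i j \<times> paths_to i j) = {}"
      by (auto simp: paths_to_def)
  qed (auto simp: card_paths_to card_cartesian_product intro!: sum.cong)
  also have "\<dots> = (\<Sum>i=0..n. \<Sum>j=0..n. card (paths_to i j \<times> paths_to i j))"
    by (rule sum.cartesian_product[symmetric])
  also have "\<dots> = kuratowski_number n"
    unfolding kuratowski_number_def
  proof (intro sum.cong refl)
    fix i j
    have "(i + j choose j) = (i + j choose i)"
      using binomial_symmetric[of i "i + j"] by simp
    then show "card (paths_to i j \<times> paths_to i j) = (i + j choose i) * (i + j choose j)"
      by (simp add: card_cartesian_product card_paths_to)
  qed
  finally show ?thesis .
qed

section \<open>The Kuratowski monoids of maximal size\<close>

lemma records_image:
  "(\<lambda>w. (records w, records (rev w))) ` {w. levels_within (\<lambda>_. n) w} =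
    {(P, Q). P \<in> paths_within n \<and> count_list P = count_list Q}"
proof (intro equalityI subsetI)
  fix p assume "p \<in> (\<lambda>w. (records w, records (rev w))) ` {w. levels_within (\<lambda>_. n) w}"
  then obtain w where "levels_within (\<lambda>_. n) w" "p = (records w, records (rev w))" by auto
  then show "p \<in> {(P, Q). P \<in> paths_within n \<and> count_list P = count_list Q}"
    by (simp add: fun_eq_iff count_list_records_rev levels_within_records_iff paths_within_def)
next
  fix p assume "p \<in> {(P, Q). P \<in> paths_within n \<and> count_list P = count_list Q}"
  then obtain P Q where p: "p = (P, Q)" "P \<in> paths_within n" "count_list P = count_list Q" by auto
  let ?w = "path_word P @ rev (path_word Q)"
  have "levels_within (\<lambda>_. n) ?w"
    using p(2) by (simp add: levels_within_path_word paths_within_def p(3))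
  moreover have "records ?w = P" using p(3) by (rule records_path_pair)
  moreover have "records (rev ?w) = Q" using records_path_pair[OF p(3)[symmetric]] by simp
  ultimately show "p \<in> (\<lambda>w. (records w, records (rev w))) ` {w. levels_within (\<lambda>_. n) w}"
    using p(1) by (intro image_eqI[of _ _ ?w]) simp_all
qed

lemma card_image_eq_if_same_kernel:
  assumes "\<And>x y. x \<in> S \<Longrightarrow> y \<in> S \<Longrightarrow> f x = f y \<longleftrightarrow> g x = g y"
  shows "card (f ` S) = card (g ` S)"
proof -
  let ?h = "\<lambda>z. g (inv_into S f z)"
  have h: "?h (f x) = g x" if "x \<in> S" for x
    using assms[of "inv_into S f (f x)" x] that
      inv_into_into[of "f x" f S] f_inv_into_f[of "f x" f S] by blast
  have "inj_on ?h (f ` S)"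
  proof (rule inj_onI)
    fix u v assume "u \<in> f ` S" "v \<in> f ` S" "?h u = ?h v"
    then obtain x y where "x \<in> S" "y \<in> S" "u = f x" "v = f y" "?h (f x) = ?h (f y)" by blast
    then show "u = v" using assms[of x y] h[of x] h[of y] by simp
  qed
  moreover have "?h ` f ` S = g ` S"
    unfolding image_image using h by (rule image_cong[OF refl])
  ultimately show ?thesis using card_image[of ?h "f ` S"] by simp
qed

theorem theorem1p2:
  fixes n :: nat
  shows "\<exists>(X :: nat set) (T :: nat \<Rightarrow> nat topology).
           n_topological_space n X T \<and>
           card (kuratowski_monoid n X T) = kuratowski_number n \<and>
           card (full_kuratowski_monoid n X T) = 2 * kuratowski_number n"
proof -
  let ?W = "paths_within n \<times> paths_within n"
  interpret closure_interior_poset ?W path_pair_le path_pair_act n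
    by (rule path_pair_poset)
  have "finite (Pow ?W)" by (simp add: finite_paths_within)
  then have "finite up_sets"
    by (rule rev_finite_subset) (auto simp: up_sets_def)
  then obtain val where "bij_betw val {0..<card up_sets} up_sets"
    using ex_bij_betw_nat_finite by blast
  then interpret up_set_space ?W path_pair_le path_pair_act n "{0..<card up_sets}" val
    by unfold_locales
  \<comment> \<open>Larger indices mean finer topologies, whereas higher levels mean coarser ones.\<close>
  let ?X = "{0..<card up_sets}" and ?T = "\<lambda>i. level_topology (n - i)"
  let ?S = "bounded_words n"
  have "card (word_map ` ?S) = card ((\<lambda>w. (records w, records (rev w))) ` ?S)"
  proof (rule card_image_eq_if_same_kernel)
    fix v w assume vw: "v \<in> ?S" "w \<in> ?S"
    have start: "([], []) \<in> ?W" by (simp add: paths_within_def)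
    show "word_map v = word_map w \<longleftrightarrow>
        (records v, records (rev v)) = (records w, records (rev w))"
    proof
      assume "word_map v = word_map w"
      from word_map_eqD[OF start _ _ this] vw
      show "(records v, records (rev v)) = (records w, records (rev w))"
        by (simp add: fold_path_pair_act)
    qed (auto intro: word_map_eqI)
  qed
  then have card: "card (word_map ` ?S) = kuratowski_number n"
    by (simp only: records_image card_path_pairs)
  \<comment> \<open>Positivity is what makes the set of operators finite: an infinite set would have cardinality \<open>0\<close>.\<close>
  have "0 < kuratowski_number n"
    unfolding kuratowski_number_def by (rule sum_pos) (auto intro!: sum_pos)
  then have "finite (word_map ` ?S)" "finite (co_word_map ` ?S)"
    using card card_co_word_map[of ?S] by (simp_all add: card_ge_0_finite)
  then have "card (full_kuratowski_monoid n ?X ?T) = 2 * kuratowski_number n"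
    using word_map_co_word_map_disjoint[OF space_nonempty] card card_co_word_map[of ?S]
    by (simp add: full_kuratowski_monoid_eq card_Un_disjoint)
  moreover have "card (kuratowski_monoid n ?X ?T) = kuratowski_number n"
    using card by (simp add: kuratowski_monoid_eq)
  moreover have "n_topological_space n ?X ?T"
    unfolding n_topological_space_def by (auto simp: topspace_tower intro: coarser[OF diff_le_mono2])
  ultimately show ?thesis by blast
qed

end
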